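(* Let $P$ be a convex polygon in $\mathbb{R}^2$ with $m\ge 7$ edges and let $$P=(p_1,\ldots,p_m)_{\ge 0}=(q_1,q_2)_{\ge 0},$$ where $p_1,\ldots,p_m,q_1,q_2\in\mathbb{R}[x]$ and $p_1,\ldots,p_m$ are of degree one. Then there exist $k_1,\ldots,k_m\in\mathbb{N}$ and $g_1,g_2\in\mathbb{R}[x]$ such that $$\{q_1,q_2\}=\{p_1^{k_1}\cdots p_m^{k_m}\,g_1,\ g_2\}$$ and the following conditions are fulfilled: 1. $k_1,\ldots,k_m$ are odd; 2. $g_1$ and $g_2$ are not divisible by $p_i$ for every $i\in\{1,\ldots,m\}$ (that is, no $p_i$ divides $g_1$ and no $p_i$ divides $g_2$); 3. $g_2(y)=0$ for every vertex $y$ of $P$.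
   Context: Here $\mathbb{R}[x]=\mathbb{R}[x_1,x_2]$ is the ring of real polynomials in two variables. For $g_1,\ldots,g_k\in\mathbb{R}[x]$, $(g_1,\ldots,g_k)_{\ge 0}=\{x\in\mathbb{R}^2: g_1(x)\ge 0,\ldots,g_k(x)\ge 0\}$. A convex polygon is a $2$-dimensional polytope in $\mathbb{R}^2$, i.e. the convex hull of a finite set of points, having non-empty interior. *)

theory Defs
  imports "HOL-Analysis.Analysis" "HOL-Computational_Algebra.Computational_Algebra"
begin

(* R[x1, x2] is represented as R[x1][x2]: the coefficient of x1^i * x2^j in p is
   coeff (coeff p j) i (see eval_bipoly_altdef). *)
type_synonym bipoly = "real poly poly"

definition eval_bipoly :: "bipoly \<Rightarrow> real ^ 2 \<Rightarrow> real" where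
  "eval_bipoly p x = poly (poly p [:x $ 2:]) (x $ 1)"

definition monomials :: "bipoly \<Rightarrow> (nat \<times> nat) set" where
  "monomials p = {(i, j). coeff (coeff p j) i \<noteq> 0}"

(* Convention: the zero polynomial gets total degree 0. *)
definition total_degree :: "bipoly \<Rightarrow> nat" where
  "total_degree p = Max (insert 0 ((\<lambda>(i, j). i + j) ` monomials p))"

definition nonneg_set :: "bipoly set \<Rightarrow> (real ^ 2) set" where
  "nonneg_set G = {x. \<forall>g\<in>G. eval_bipoly g x \<ge> 0}"

definition convex_polygon :: "(real ^ 2) set \<Rightarrow> bool" where
  "convex_polygon P \<longleftrightarrow> polytope P \<and> interior P \<noteq> {}"

lemma eval_bipoly_altdef:
  "eval_bipoly p x =
     (\<Sum>j\<le>degree p. \<Sum>i\<le>degree (coeff p j). coeff (coeff p j) i * (x $ 1) ^ i * (x $ 2) ^ j)"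
  by (simp add: eval_bipoly_def poly_altdef[of p] poly_sum poly_mult poly_power
      poly_altdef[of "coeff p _"] sum_distrib_right)

lemma finite_monomials: "finite (monomials p)"
proof -
  have "monomials p \<subseteq> (\<Union>j\<in>{..degree p}. (\<lambda>i. (i, j)) ` {..degree (coeff p j)})"
  proof
    fix z
    assume "z \<in> monomials p"
    then obtain i j where z: "z = (i, j)" and nz: "coeff (coeff p j) i \<noteq> 0"
      by (auto simp: monomials_def)
    from nz have "coeff p j \<noteq> 0" by auto
    then have "j \<le> degree p" by (rule le_degree)
    moreover have "i \<le> degree (coeff p j)" using nz by (rule le_degree)
    ultimately show "z \<in> (\<Union>j\<in>{..degree p}. (\<lambda>i. (i, j)) ` {..degree (coeff p j)})"
      using z by auto
  qed
  then show ?thesis by (rule finite_subset) auto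
qed

end

theory Submission
  imports Defs "HOL-Computational_Algebra.Field_as_Ring"
begin

text \<open>
  Write \<open>L i\<close> for the line \<open>p i = 0\<close>. Near an interior point of the edge on \<open>L i\<close> there are points outside
  \<open>P\<close>, so \<open>q1\<close> and \<open>q2\<close> cannot both be positive at that point. Hence one of them vanishes at infinitely
  many points of \<open>L i\<close> and is divisible by \<open>p i\<close> (\<open>dvd_one_of_two\<close>). They are not both divisible by
  \<open>p i\<close>, because \<open>P\<close> does not contain \<open>L i\<close> (\<open>not_dvd_both\<close>). If \<open>p i\<close> divides \<open>q1\<close>, then on \<open>L i\<close> it is \<open>q2\<close>
  alone that decides membership in \<open>P\<close>: it is negative at the points of \<open>L i\<close> outside \<open>P\<close>.

  The heart of the proof is that all the \<open>p i\<close> divide the same one of \<open>q1\<close> and \<open>q2\<close>. Suppose that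
  \<open>p i\<close> divides \<open>q1\<close> and \<open>p j\<close> divides \<open>q2\<close>. If \<open>L i\<close> and \<open>L j\<close> crossed outside \<open>P\<close>, then \<open>q2\<close> would be
  negative and zero at the crossing. So \<open>L i\<close> and \<open>L j\<close> are parallel or meet in \<open>P\<close>
  (\<open>parallel_or_meet_in_P\<close>). But a given edge line is parallel to at most one other and meets at most
  two others in \<open>P\<close>, namely those of the adjacent edges. Hence if \<open>q1\<close> and \<open>q2\<close> both had divisors among
  the \<open>p i\<close>, each would have at most three (\<open>card_other_divisors_le_3\<close>), and \<open>P\<close> at most six edges.

  Say all \<open>p i\<close> divide \<open>q1\<close>. Crossing an edge at an interior point where \<open>q2\<close> is positive, \<open>q1\<close> must
  change sign, so the multiplicity of \<open>p i\<close> in \<open>q1\<close> is odd (\<open>odd_exponent\<close>). At a vertex on \<open>L i\<close>, the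
  nonnegative value of \<open>q2\<close> is a limit of negative values on \<open>L i\<close> outside \<open>P\<close>, hence zero
  (\<open>zero_at_extreme_point\<close>).

  All facts about the arrangement of the lines \<open>L i\<close> come from one observation, \<open>no_linear_relation\<close>:
  no three of the \<open>p i\<close> are linearly dependent. This holds because each edge has a point at which every
  other \<open>p j\<close> is positive, which in turn follows by comparing the number of edges with the number of
  inequalities (\<open>irredundant_polygonI\<close>).
\<close>

section \<open>Bivariate polynomials of degree one\<close>

lemma eval_bipoly_mult: "eval_bipoly (f * g) x = eval_bipoly f x * eval_bipoly g x"
  by (simp add: eval_bipoly_def)

lemma eval_bipoly_power: "eval_bipoly (f ^ n) x = eval_bipoly f x ^ n"
  by (simp add: eval_bipoly_def poly_power)

lemma continuous_on_eval_bipoly: "continuous_on A (eval_bipoly q)"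
proof -
  have "eval_bipoly q = (\<lambda>x. \<Sum>j\<le>degree q. \<Sum>i\<le>degree (coeff q j).
      coeff (coeff q j) i * (x $ 1) ^ i * (x $ 2) ^ j)"
    by (rule ext) (rule eval_bipoly_altdef)
  then show ?thesis by (auto intro!: continuous_intros)
qed

text \<open>For \<open>l\<close> of degree one this is the gradient of \<open>l\<close>, which points into the half-plane \<open>l \<ge> 0\<close>.\<close>

definition normal :: "bipoly \<Rightarrow> real ^ 2" where
  "normal l = vector [coeff (coeff l 0) 1, coeff (coeff l 1) 0]"

lemma degree_one_form:
  assumes "total_degree l = 1"
  shows "l = [:[:coeff (coeff l 0) 0, normal l $ 1:], [:normal l $ 2:]:]"
    and "normal l \<noteq> 0"
proof -
  have fin: "finite (insert 0 ((\<lambda>(i, j). i + j) ` monomials l))"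
    by (simp add: finite_monomials)
  have zero: "coeff (coeff l j) i = 0" if "i + j > 1" for i j
  proof (rule ccontr)
    assume "coeff (coeff l j) i \<noteq> 0"
    then have "(i, j) \<in> monomials l" by (simp add: monomials_def)
    then have "i + j \<in> insert 0 ((\<lambda>(i, j). i + j) ` monomials l)" by force
    from Max_ge[OF fin this] show False
      using assms that by (simp add: total_degree_def)
  qed
  show "l = [:[:coeff (coeff l 0) 0, normal l $ 1:], [:normal l $ 2:]:]"
  proof (intro poly_eqI)
    fix j i
    show "coeff (coeff l j) i
        = coeff (coeff [:[:coeff (coeff l 0) 0, normal l $ 1:], [:normal l $ 2:]:] j) i"
      using zero[of i j] by (auto simp: coeff_pCons normal_def split: nat.splits)
  qed
  have "1 \<in> insert 0 ((\<lambda>(i, j). i + j) ` monomials l)"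
    using Max_in[OF fin] assms by (auto simp: total_degree_def)
  then obtain i j where ij: "coeff (coeff l j) i \<noteq> 0" "i + j = 1"
    by (auto simp: monomials_def)
  then have "i = 1 \<and> j = 0 \<or> i = 0 \<and> j = 1" by auto
  with ij(1) show "normal l \<noteq> 0"
    by (auto simp: normal_def vec_eq_iff forall_2)
qed

lemma eval_degree_one_add:
  assumes "total_degree l = 1"
  shows "eval_bipoly l (x + v) = eval_bipoly l x + normal l \<bullet> v"
proof -
  obtain c where l: "l = [:[:c, normal l $ 1:], [:normal l $ 2:]:]"
    using degree_one_form(1)[OF assms] by blast
  have "eval_bipoly l y = c + normal l $ 1 * y $ 1 + normal l $ 2 * y $ 2" for y
    by (subst l) (simp add: eval_bipoly_def algebra_simps)
  then show ?thesis by (simp add: inner_vec_def sum_2 algebra_simps)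
qed

lemma poly_poly_const_eval: "poly (poly q [:poly r u:]) u = poly (poly q r) u"
  for q :: "real poly poly"
  by (induction q) (simp_all add: algebra_simps)

lemma poly_poly_map_poly: "poly (poly q [:v:]) u = poly (map_poly (\<lambda>h. poly h u) q) v"
  for q :: "real poly poly"
  by (induction q) (simp_all add: map_poly_pCons)

text \<open>
  Solving \<open>l = 0\<close> for one of the two variables parametrises the line by the other one. Substituting
  this parametrisation into \<open>q\<close> gives a univariate polynomial, which has infinitely many roots and
  hence vanishes; this says that \<open>q\<close> is a multiple of \<open>l\<close>.
\<close>

lemma degree_one_dvdI:
  assumes deg: "total_degree l = 1"
    and inf: "infinite {x. eval_bipoly l x = 0 \<and> eval_bipoly q x = 0}" (is "infinite ?S")
  shows "l dvd q"
proof -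
  define a b where "a = normal l $ 1" and "b = normal l $ 2"
  obtain c where l: "l = [:[:c, a:], [:b:]:]"
    using degree_one_form(1)[OF deg] unfolding a_def b_def by blast
  have ab: "a \<noteq> 0 \<or> b \<noteq> 0"
    using degree_one_form(2)[OF deg] by (auto simp: a_def b_def vec_eq_iff forall_2)
  have line: "c + a * x $ 1 + b * x $ 2 = 0" if "x \<in> ?S" for x :: "real ^ 2"
    using that by (simp add: l eval_bipoly_def algebra_simps)
  show ?thesis
  proof (cases "b = 0")
    case False
    define r where "r = [:-c / b, -a / b:]"
    have x2: "x $ 2 = poly r (x $ 1)" if "x \<in> ?S" for x :: "real ^ 2"
      using line[OF that] False by (simp add: r_def field_simps)
    have "inj_on (\<lambda>x::real^2. x $ 1) ?S"
      by (rule inj_onI) (simp add: x2 vec_eq_iff forall_2 del: mem_Collect_eq)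
    then have "infinite ((\<lambda>x::real^2. x $ 1) ` ?S)"
      using inf finite_imageD by blast
    moreover have "(\<lambda>x::real^2. x $ 1) ` ?S \<subseteq> {u. poly (poly q r) u = 0}"
    proof safe
      fix x :: "real ^ 2" assume "eval_bipoly l x = 0" and q: "eval_bipoly q x = 0"
      then have "x $ 2 = poly r (x $ 1)" by (intro x2) simp
      with q show "poly (poly q r) (x $ 1) = 0"
        by (simp add: eval_bipoly_def poly_poly_const_eval)
    qed
    ultimately have "infinite {u. poly (poly q r) u = 0}"
      using finite_subset by blast
    then have "poly q r = 0" using poly_roots_finite by blast
    then obtain h where h: "q = [:- r, 1:] * h"
      unfolding poly_eq_0_iff_dvd by (auto simp: dvd_def)
    have l_r: "l = smult [:b:] [:- r, 1:]" using False by (simp add: l r_def)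
    have unit: "[:b:] * [:1 / b:] = 1" using False by (simp add: one_pCons)
    have "l * smult [:1 / b:] h = smult ([:b:] * [:1 / b:]) ([:- r, 1:] * h)"
      unfolding l_r by (simp only: mult_smult_left mult_smult_right smult_smult mult.commute)
    then have "l * smult [:1 / b:] h = q" by (simp only: unit h smult_1_left)
    then show ?thesis by (metis dvd_triv_left)
  next
    case True
    with ab have a: "a \<noteq> 0" by simp
    define u where "u = -c / a"
    have x1: "x $ 1 = u" if "x \<in> ?S" for x :: "real ^ 2"
      using line[OF that] a True by (simp add: u_def field_simps)
    have "inj_on (\<lambda>x::real^2. x $ 2) ?S"
      by (rule inj_onI) (simp add: x1 vec_eq_iff forall_2 del: mem_Collect_eq)
    then have "infinite ((\<lambda>x::real^2. x $ 2) ` ?S)"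
      using inf finite_imageD by blast
    moreover have "(\<lambda>x::real^2. x $ 2) ` ?S \<subseteq> {v. poly (map_poly (\<lambda>h. poly h u) q) v = 0}"
    proof safe
      fix x :: "real ^ 2" assume "eval_bipoly l x = 0" and q: "eval_bipoly q x = 0"
      then have "x $ 1 = u" by (intro x1) simp
      with q show "poly (map_poly (\<lambda>h. poly h u) q) (x $ 2) = 0"
        by (simp add: eval_bipoly_def poly_poly_map_poly)
    qed
    ultimately have "infinite {v. poly (map_poly (\<lambda>h. poly h u) q) v = 0}"
      using finite_subset by blast
    then have zero: "map_poly (\<lambda>h. poly h u) q = 0" using poly_roots_finite by blast
    have "[:c, a:] dvd coeff q n" for n
    proof -
      have "poly (coeff q n) u = coeff (map_poly (\<lambda>h. poly h u) q) n"
        by (simp add: coeff_map_poly)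
      then have "[:-u, 1:] dvd coeff q n"
        using zero by (simp add: poly_eq_0_iff_dvd)
      then have "smult a [:-u, 1:] dvd coeff q n"
        using a by (subst smult_dvd_iff) simp
      then show ?thesis using a by (simp add: u_def)
    qed
    then have "[:[:c, a:]:] dvd q" by (simp add: const_poly_dvd_iff)
    then show ?thesis by (simp add: l True)
  qed
qed

lemma eval_bipoly_eq_0_if_dvd:
  assumes "l dvd q" and "eval_bipoly l x = 0"
  shows "eval_bipoly q x = 0"
  using assms by (auto simp: dvd_def eval_bipoly_mult)

definition rot :: "real ^ 2 \<Rightarrow> real ^ 2" where
  "rot v = vector [- (v $ 2), v $ 1]"

lemma inner_rot_self [simp]: "v \<bullet> rot v = 0"
  by (simp add: rot_def inner_vec_def sum_2)

lemma rot_eq_0_iff [simp]: "rot v = 0 \<longleftrightarrow> v = 0"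
  by (auto simp: rot_def vec_eq_iff forall_2)

lemma eval_degree_one_rot:
  assumes "total_degree l = 1"
  shows "eval_bipoly l (x + t *\<^sub>R rot (normal l)) = eval_bipoly l x"
  by (simp add: eval_degree_one_add[OF assms])

lemma infinite_line_image:
  fixes x :: "real ^ 2"
  assumes "infinite T" and "v \<noteq> 0"
  shows "infinite ((\<lambda>t. x + t *\<^sub>R v) ` T)"
proof -
  have "inj_on (\<lambda>t. x + t *\<^sub>R v) T"
    using assms(2) by (intro inj_onI) simp
  then show ?thesis using assms(1) finite_imageD by blast
qed

lemma eval_degree_one_zero_exists:
  assumes "total_degree l = 1"
  shows "\<exists>x. eval_bipoly l x = 0"
proof -
  let ?n = "normal l"
  have "eval_bipoly l (0 + (- eval_bipoly l 0 / (?n \<bullet> ?n)) *\<^sub>R ?n) = 0"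
    using degree_one_form(2)[OF assms] by (subst eval_degree_one_add[OF assms]) simp
  then show ?thesis by blast
qed

lemma prime_elem_degree_one:
  assumes deg: "total_degree l = 1"
  shows "prime_elem l"
proof (rule prime_elemI)
  obtain x where x: "eval_bipoly l x = 0" using eval_degree_one_zero_exists[OF deg] by blast
  show "l \<noteq> 0" using deg degree_one_form(2)[OF deg] by (auto simp: normal_def vec_eq_iff forall_2)
  show "\<not> is_unit l"
  proof
    assume "is_unit l"
    from eval_bipoly_eq_0_if_dvd[OF this x] show False by (simp add: eval_bipoly_def)
  qed
  fix f g assume "l dvd f * g"
  then have "eval_bipoly f y = 0 \<or> eval_bipoly g y = 0" if "eval_bipoly l y = 0" for y
    using eval_bipoly_eq_0_if_dvd[OF _ that] by (fastforce simp: eval_bipoly_mult)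
  then have "range (\<lambda>t. x + t *\<^sub>R rot (normal l))
      \<subseteq> {y. eval_bipoly l y = 0 \<and> eval_bipoly f y = 0}
        \<union> {y. eval_bipoly l y = 0 \<and> eval_bipoly g y = 0}"
    using eval_degree_one_rot[OF deg, of x] x by fastforce
  moreover have "infinite (range (\<lambda>t. x + t *\<^sub>R rot (normal l)))"
    by (rule infinite_line_image)
      (simp_all add: degree_one_form(2)[OF deg] infinite_UNIV_char_0)
  ultimately have "infinite {y. eval_bipoly l y = 0 \<and> eval_bipoly f y = 0}
      \<or> infinite {y. eval_bipoly l y = 0 \<and> eval_bipoly g y = 0}"
    using finite_subset by blast
  then show "l dvd f \<or> l dvd g" using degree_one_dvdI[OF deg] by blast
qed

text \<open>
  Powers of distinct primes are coprime, so that their product divides \<open>f\<close> as soon as each of them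
  does; maximality of the exponents passes to the cofactor.
\<close>

lemma prod_multiplicity_decompose:
  fixes f :: "'a :: factorial_semiring_gcd"
  assumes "finite I" and "f \<noteq> 0" and prime: "\<And>i. i \<in> I \<Longrightarrow> prime_elem (p i)"
    and ndvd: "\<And>i j. i \<in> I \<Longrightarrow> j \<in> I \<Longrightarrow> i \<noteq> j \<Longrightarrow> \<not> p i dvd p j"
  obtains h where "f = (\<Prod>i\<in>I. p i ^ multiplicity (p i) f) * h" "\<forall>i\<in>I. \<not> p i dvd h"
proof -
  let ?e = "\<lambda>i. p i ^ multiplicity (p i) f"
  have "(\<Prod>i\<in>J. ?e i) dvd f" if "finite J" "J \<subseteq> I" for J
    using that
  proof (induction J rule: finite_induct)
    case (insert i J)
    have "coprime (\<Prod>j\<in>J. ?e j) (?e i)"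
    proof (rule prod_coprime_left)
      fix j assume "j \<in> J"
      with insert have "coprime (p j) (p i)"
        by (intro prime_elem_imp_coprime prime ndvd) auto
      then show "coprime (?e j) (?e i)" by simp
    qed
    with insert show ?case
      by (simp add: multiplicity_dvd divides_mult coprime_commute)
  qed simp
  then obtain h where h: "f = (\<Prod>i\<in>I. ?e i) * h" using assms(1) by blast
  have "\<not> p i dvd h" if i: "i \<in> I" for i
  proof
    assume "p i dvd h"
    then have "?e i * p i dvd (\<Prod>i\<in>I. ?e i) * h"
      using assms(1) i by (intro mult_dvd_mono dvd_prodI) auto
    then have "p i ^ Suc (multiplicity (p i) f) dvd f" using h by (simp add: mult.commute)
    moreover have "\<not> is_unit (p i)" using prime[OF i] by (simp add: prime_elem_def)
    ultimately show False using assms(2) power_dvd_iff_le_multiplicity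
      by (metis Suc_n_not_le_n)
  qed
  with h show thesis by (intro that) auto
qed

section \<open>Irredundant descriptions of a bounded set by half-planes\<close>

lemma inner_rot_commute: "rot u \<bullet> v = - (rot v \<bullet> u)"
  by (simp add: rot_def inner_vec_def sum_2)

lemma parallel_if_inner_rot_eq_0:
  assumes "rot u \<bullet> v = 0" and "u \<noteq> 0"
  obtains r where "v = r *\<^sub>R u"
proof
  have uu: "u \<bullet> u \<noteq> 0" using assms(2) by simp
  have "u $ 1 * v $ 2 = u $ 2 * v $ 1"
    using assms(1) by (simp add: rot_def inner_vec_def sum_2)
  then have "(u \<bullet> u) *\<^sub>R v = (u \<bullet> v) *\<^sub>R u"
    by (simp add: vec_eq_iff forall_2 inner_vec_def sum_2) algebra
  then show "v = ((u \<bullet> v) / (u \<bullet> u)) *\<^sub>R u"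
    using uu by (metis (no_types, lifting) divide_inverse_commute inverse_eq_divide
        real_vector.scale_left_imp_eq scaleR_one scaleR_scaleR right_inverse)
qed

lemma point_on_line:
  assumes deg: "total_degree l = 1" and "eval_bipoly l x = 0" "eval_bipoly l y = 0"
  obtains t where "x = y + t *\<^sub>R rot (normal l)"
proof -
  let ?n = "normal l"
  have "normal l \<bullet> (x - y) = 0"
    using eval_degree_one_add[OF deg, of y "x - y"] assms by simp
  then have "rot (rot ?n) \<bullet> (x - y) = 0"
    by (simp add: rot_def inner_vec_def sum_2)
  with parallel_if_inner_rot_eq_0 obtain t where "x - y = t *\<^sub>R rot ?n"
    by (metis degree_one_form(2)[OF deg] rot_eq_0_iff)
  then have "x = y + t *\<^sub>R rot ?n" by (simp add: algebra_simps)
  then show thesis by (rule that)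
qed

lemma eventually_eval_bipoly_pos:
  assumes "eval_bipoly q z > 0"
  shows "\<forall>\<^sub>F s in nhds 0. eval_bipoly q (z + s *\<^sub>R v) > 0"
proof -
  have "continuous_on UNIV (\<lambda>s. eval_bipoly q (z + s *\<^sub>R v))"
    by (intro continuous_on_compose2[OF continuous_on_eval_bipoly[of UNIV]] continuous_intros) auto
  then have "isCont (\<lambda>s. eval_bipoly q (z + s *\<^sub>R v)) 0"
    by (simp add: continuous_on_eq_continuous_at)
  then have "((\<lambda>s. eval_bipoly q (z + s *\<^sub>R v)) \<longlongrightarrow> eval_bipoly q (z + 0 *\<^sub>R v)) (nhds 0)"
    by (simp add: isCont_def tendsto_nhds_iff)
  then show ?thesis using assms by (intro order_tendstoD(1)) auto
qed

lemma eventually_nhds_0_symmetric: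
  assumes "\<forall>\<^sub>F s in nhds (0::real). Q s"
  obtains s where "s > 0" "Q s" "Q (- s)"
proof -
  obtain d where "d > 0" "\<And>s. dist s 0 < d \<Longrightarrow> Q s"
    using assms by (auto simp: eventually_nhds_metric)
  then show thesis using that[of "d / 2"] by (simp add: dist_real_def)
qed

lemma mem_nonneg_set_pair:
  "x \<in> nonneg_set {f, g} \<longleftrightarrow> eval_bipoly f x \<ge> 0 \<and> eval_bipoly g x \<ge> 0"
  by (simp add: nonneg_set_def)

text \<open>
  The assumption \<open>irredundant\<close> is the form in which the equality between the number of edges and the
  number of inequalities enters: each inequality has a boundary point of its own, at which all the
  others are strict.
\<close>

locale irredundant_polygon =
  fixes P :: "(real ^ 2) set" and I :: "'i set" and p :: "'i \<Rightarrow> bipoly"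
  assumes finite_I: "finite I"
    and deg: "i \<in> I \<Longrightarrow> total_degree (p i) = 1"
    and P_eq: "P = nonneg_set (p ` I)"
    and bounded_P: "bounded P"
    and irredundant: "i \<in> I \<Longrightarrow>
      \<exists>y. eval_bipoly (p i) y = 0 \<and> (\<forall>j\<in>I - {i}. eval_bipoly (p j) y > 0)"
begin

definition facet_point :: "'i \<Rightarrow> real ^ 2 \<Rightarrow> bool" where
  "facet_point i y \<longleftrightarrow> eval_bipoly (p i) y = 0 \<and> (\<forall>j\<in>I - {i}. eval_bipoly (p j) y > 0)"

text \<open>Since \<open>rot\<close> is the quarter turn, the inner product below is the determinant of the two normals.\<close>

abbreviation parallel :: "'i \<Rightarrow> 'i \<Rightarrow> bool" where
  "parallel i j \<equiv> rot (normal (p i)) \<bullet> normal (p j) = 0"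

abbreviation meet_in_P :: "'i \<Rightarrow> 'i \<Rightarrow> bool" where
  "meet_in_P i j \<equiv> \<exists>y\<in>P. eval_bipoly (p i) y = 0 \<and> eval_bipoly (p j) y = 0"

lemma mem_P_iff: "x \<in> P \<longleftrightarrow> (\<forall>i\<in>I. eval_bipoly (p i) x \<ge> 0)"
  by (simp add: P_eq nonneg_set_def)

lemma normal_nonzero: "i \<in> I \<Longrightarrow> normal (p i) \<noteq> 0"
  using deg degree_one_form(2) by blast

lemma facet_point_in_P: "facet_point i y \<Longrightarrow> y \<in> P"
  unfolding mem_P_iff facet_point_def by (metis Diff_iff less_eq_real_def singletonD)

lemma facet_point_exists: "i \<in> I \<Longrightarrow> \<exists>y. facet_point i y"
  using irredundant by (simp add: facet_point_def)

text \<open>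
  At a point of the facet of \<open>p i\<close> that lies on no other facet, the relation loses its first term,
  while \<open>p j\<close> and \<open>p k\<close> are positive; so \<open>b\<close> and \<open>c\<close> have opposite signs or both vanish. The same
  holds for the other two pairs, but three nonzero reals cannot have pairwise opposite signs.
\<close>

lemma no_linear_relation:
  assumes I: "i \<in> I" "j \<in> I" "k \<in> I" and ne: "i \<noteq> j" "i \<noteq> k" "j \<noteq> k"
    and rel: "\<And>x. a * eval_bipoly (p i) x + b * eval_bipoly (p j) x + c * eval_bipoly (p k) x = 0"
  shows "a = 0 \<and> b = 0 \<and> c = 0"
proof -
  have sgn: "sgn u = - sgn v" if "u * s + v * t = 0" "s > 0" "t > 0" for u v s t :: real
  proof -
    have "u * s = - v * t" using that(1) by simp
    then have "sgn (u * s) = sgn (- v * t)" by simp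
    then show ?thesis using that(2,3) by (simp add: sgn_mult)
  qed
  obtain y where "facet_point i y" using facet_point_exists I by blast
  then have "sgn b = - sgn c"
    using sgn[of b "eval_bipoly (p j) y" c "eval_bipoly (p k) y"] rel[of y] I ne
    by (simp add: facet_point_def)
  moreover obtain y where "facet_point j y" using facet_point_exists I by blast
  then have "sgn a = - sgn c"
    using sgn[of a "eval_bipoly (p i) y" c "eval_bipoly (p k) y"] rel[of y] I ne
    by (simp add: facet_point_def)
  moreover obtain y where "facet_point k y" using facet_point_exists I by blast
  then have "sgn a = - sgn b"
    using sgn[of a "eval_bipoly (p i) y" b "eval_bipoly (p j) y"] rel[of y] I ne
    by (simp add: facet_point_def)
  ultimately have "sgn a = 0" "sgn b = 0" "sgn c = 0" by linarith+
  then show ?thesis by (simp add: sgn_zero_iff)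
qed

text \<open>
  For parallel lines the three polynomials lie in the two-dimensional space spanned by \<open>1\<close> and one
  linear form, which forces a linear relation between them.
\<close>

lemma no_three_parallel:
  assumes I: "i \<in> I" "j \<in> I" "k \<in> I" and ne: "i \<noteq> j" "i \<noteq> k" "j \<noteq> k"
    and par: "parallel i j" "parallel i k"
  shows False
proof -
  obtain r where r: "normal (p j) = r *\<^sub>R normal (p i)"
    using parallel_if_inner_rot_eq_0[OF par(1)] normal_nonzero I by blast
  obtain s where s: "normal (p k) = s *\<^sub>R normal (p i)"
    using parallel_if_inner_rot_eq_0[OF par(2)] normal_nonzero I by blast
  define A where "A = eval_bipoly (p i) 0"
  define B where "B = eval_bipoly (p j) 0"
  define C where "C = eval_bipoly (p k) 0"
  define w where "w x = normal (p i) \<bullet> x" for x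
  have ev: "eval_bipoly (p i) x = A + w x" "eval_bipoly (p j) x = B + r * w x"
    "eval_bipoly (p k) x = C + s * w x" for x
    using eval_degree_one_add[OF deg, of _ 0 x] I
    by (simp_all add: A_def B_def C_def w_def r s)
  \<comment> \<open>\<open>p j - r * p i\<close> and \<open>p k - s * p i\<close> are constants; a combination of them vanishes.\<close>
  let ?d = "B - r * A" and ?e = "C - s * A"
  have "?d * s - ?e * r = 0 \<and> ?e = 0 \<and> - ?d = 0"
  proof -
    have "(?d * s - ?e * r) * eval_bipoly (p i) x + ?e * eval_bipoly (p j) x
        + (- ?d) * eval_bipoly (p k) x = 0" for x
      unfolding ev by (simp add: algebra_simps)
    from no_linear_relation[OF I ne this] show ?thesis by simp
  qed
  \<comment> \<open>So both constants vanish, and already \<open>p j\<close> is a multiple of \<open>p i\<close>.\<close>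
  then have "r * eval_bipoly (p i) x + (-1) * eval_bipoly (p j) x + 0 * eval_bipoly (p k) x = 0"
    for x unfolding ev by (simp add: algebra_simps)
  from no_linear_relation[OF I ne this] show False by simp
qed

text \<open>
  For lines through a common point, a linear relation between the polynomials is one between their
  normals, which are three vectors in the plane. The standard relation has the \<open>2 \<times> 2\<close> determinants
  of the normals as coefficients; if these vanish, the lines are parallel.
\<close>

lemma no_three_concurrent:
  assumes I: "i \<in> I" "j \<in> I" "k \<in> I" and ne: "i \<noteq> j" "i \<noteq> k" "j \<noteq> k"
    and y: "eval_bipoly (p i) y = 0" "eval_bipoly (p j) y = 0" "eval_bipoly (p k) y = 0"
  shows False
proof -
  let ?u = "normal (p i)" and ?v = "normal (p j)" and ?w = "normal (p k)"
  have ev: "eval_bipoly (p i) x = ?u \<bullet> (x - y)" "eval_bipoly (p j) x = ?v \<bullet> (x - y)"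
    "eval_bipoly (p k) x = ?w \<bullet> (x - y)" for x
    using eval_degree_one_add[OF deg, of _ y "x - y"] I y by simp_all
  have "(rot ?v \<bullet> ?w) * eval_bipoly (p i) x + (rot ?w \<bullet> ?u) * eval_bipoly (p j) x
      + (rot ?u \<bullet> ?v) * eval_bipoly (p k) x = 0" for x
    unfolding ev by (simp add: rot_def inner_vec_def sum_2 algebra_simps)
  from no_linear_relation[OF I ne this] have "parallel i j" "parallel i k"
    by (simp_all add: inner_rot_commute[of ?u ?w])
  with no_three_parallel[OF I ne] show False by blast
qed

lemma lines_meet:
  assumes I: "i \<in> I" "j \<in> I" and "\<not> parallel i j"
  obtains x where "eval_bipoly (p i) x = 0" "eval_bipoly (p j) x = 0"
proof -
  let ?v = "rot (normal (p i))"
  obtain y where y: "eval_bipoly (p i) y = 0"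
    using eval_degree_one_zero_exists deg I by blast
  define t where "t = - eval_bipoly (p j) y / (normal (p j) \<bullet> ?v)"
  have "eval_bipoly (p i) (y + t *\<^sub>R ?v) = 0"
    using y by (simp add: eval_degree_one_rot deg I)
  moreover have "eval_bipoly (p j) (y + t *\<^sub>R ?v) = 0"
    using assms(3) by (subst eval_degree_one_add[OF deg]) (simp_all add: I t_def inner_commute)
  ultimately show thesis by (rule that)
qed

text \<open>
  Along the line \<open>p i = 0\<close>, the polynomial \<open>p k\<close> is affine. It is nonnegative at the two outer points
  because they belong to \<open>P\<close>, and nonzero there because no three of the lines are concurrent; so it
  cannot vanish between them. Consequently a line meets at most two of the others inside \<open>P\<close>.
\<close>

lemma no_middle_meeting_point:
  assumes I: "i \<in> I" "j \<in> I" "k \<in> I" "l \<in> I"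
    and ne: "i \<noteq> j" "i \<noteq> k" "i \<noteq> l" "j \<noteq> k" "k \<noteq> l"
    and onP: "y + r *\<^sub>R v \<in> P" "y + t *\<^sub>R v \<in> P"
    and on_i: "\<And>c. eval_bipoly (p i) (y + c *\<^sub>R v) = 0"
    and on: "eval_bipoly (p j) (y + r *\<^sub>R v) = 0" "eval_bipoly (p k) (y + s *\<^sub>R v) = 0"
      "eval_bipoly (p l) (y + t *\<^sub>R v) = 0"
    and le: "r \<le> s" "s \<le> t"
  shows False
proof -
  define A B where "A = eval_bipoly (p k) y" and "B = normal (p k) \<bullet> v"
  have ev: "eval_bipoly (p k) (y + c *\<^sub>R v) = A + c * B" for c
    by (simp add: A_def B_def eval_degree_one_add deg I)
  have "A + r * B \<noteq> 0"
    using no_three_concurrent[of i j k "y + r *\<^sub>R v"] I ne on_i on ev by auto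
  moreover have "A + r * B \<ge> 0" using onP(1) I ev mem_P_iff by metis
  ultimately have 1: "A + r * B > 0" by simp
  have "A + t * B \<noteq> 0"
    using no_three_concurrent[of i k l "y + t *\<^sub>R v"] I ne on_i on ev by auto
  moreover have "A + t * B \<ge> 0" using onP(2) I ev mem_P_iff by metis
  ultimately have 2: "A + t * B > 0" by simp
  have 3: "A + s * B = 0" using on ev by simp
  show False
  proof (cases "B \<ge> 0")
    case True
    then have "r * B \<le> s * B" using le by (simp add: mult_right_mono)
    with 1 3 show False by linarith
  next
    case False
    then have "t * B \<le> s * B" using le by (simp add: mult_right_mono_neg)
    with 2 3 show False by linarith
  qed
qed

lemma card_meeting_le_2:
  assumes i: "i \<in> I"
  shows "card {j \<in> I - {i}. meet_in_P i j} \<le> 2" (is "card ?M \<le> 2")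
proof (rule ccontr)
  assume "\<not> card ?M \<le> 2"
  then have "3 \<le> card ?M" by simp
  then obtain T where T: "T \<subseteq> ?M" "card T = 3" by (rule obtain_subset_with_card_n)
  from T(2) obtain j k l where jkl: "T = {j, k, l}" "j \<noteq> k" "k \<noteq> l" "j \<noteq> l"
    by (auto simp: card_3_iff)
  let ?v = "rot (normal (p i))"
  obtain y where y: "eval_bipoly (p i) y = 0" using eval_degree_one_zero_exists deg i by blast
  have on_i: "eval_bipoly (p i) (y + c *\<^sub>R ?v) = 0" for c
    using y by (simp add: eval_degree_one_rot deg i)
  have par: "\<exists>c. y + c *\<^sub>R ?v \<in> P \<and> eval_bipoly (p h) (y + c *\<^sub>R ?v) = 0" if h: "h \<in> T" for h
  proof -
    obtain x where "x \<in> P" "eval_bipoly (p i) x = 0" "eval_bipoly (p h) x = 0"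
      using T h by blast
    moreover then obtain c where "x = y + c *\<^sub>R ?v"
      using point_on_line[OF deg[OF i] _ y] by blast
    ultimately show ?thesis by blast
  qed
  obtain r where r: "y + r *\<^sub>R ?v \<in> P" "eval_bipoly (p j) (y + r *\<^sub>R ?v) = 0"
    using par[of j] jkl by auto
  obtain s where s: "y + s *\<^sub>R ?v \<in> P" "eval_bipoly (p k) (y + s *\<^sub>R ?v) = 0"
    using par[of k] jkl by auto
  obtain t where t: "y + t *\<^sub>R ?v \<in> P" "eval_bipoly (p l) (y + t *\<^sub>R ?v) = 0"
    using par[of l] jkl by auto
  have I: "j \<in> I" "k \<in> I" "l \<in> I" "i \<noteq> j" "i \<noteq> k" "i \<noteq> l" using T jkl by auto
  note mid = no_middle_meeting_point[OF i, where y = y and v = ?v, OF _ _ _ _ _ _ _ _ _ _ on_i]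
  have "\<not> (r \<le> s \<and> s \<le> t)" "\<not> (t \<le> s \<and> s \<le> r)"
    using mid[of j k l r t s] mid[of l k j t r s] I jkl r s t by auto
  moreover have "\<not> (s \<le> r \<and> r \<le> t)" "\<not> (t \<le> r \<and> r \<le> s)"
    using mid[of k j l s t r] mid[of l j k t s r] I jkl r s t by auto
  moreover have "\<not> (r \<le> t \<and> t \<le> s)" "\<not> (s \<le> t \<and> t \<le> r)"
    using mid[of j l k r s t] mid[of k l j s r t] I jkl r s t by auto
  ultimately show False by linarith
qed

lemma card_parallel_le_1:
  assumes i: "i \<in> I"
  shows "card {j \<in> I - {i}. parallel i j} \<le> 1"
proof -
  have "j = k" if "j \<in> I - {i}" "parallel i j" "k \<in> I - {i}" "parallel i k" for j k
    using no_three_parallel[of i j k] i that by blast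
  then show ?thesis
    by (subst One_nat_def, subst card_le_Suc0_iff_eq) (auto simp: finite_I)
qed

lemma eventually_facet_point:
  assumes y: "facet_point i y" and i: "i \<in> I"
  shows "\<forall>\<^sub>F t in nhds 0. facet_point i (y + t *\<^sub>R rot (normal (p i)))"
proof -
  have "\<forall>\<^sub>F t in nhds 0. \<forall>j\<in>I - {i}. eval_bipoly (p j) (y + t *\<^sub>R rot (normal (p i))) > 0"
    using y finite_I
    by (intro eventually_ball_finite ballI eventually_eval_bipoly_pos) (auto simp: facet_point_def)
  then show ?thesis
    using y i by (simp add: facet_point_def eval_degree_one_rot deg)
qed

lemma eventually_transversal_mem_P_iff:
  assumes y: "facet_point i y" and i: "i \<in> I"
  shows "\<forall>\<^sub>F s in nhds 0. y + s *\<^sub>R normal (p i) \<in> P \<longleftrightarrow> s \<ge> 0"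
proof -
  have "\<forall>\<^sub>F s in nhds 0. \<forall>j\<in>I - {i}. eval_bipoly (p j) (y + s *\<^sub>R normal (p i)) > 0"
    using y finite_I
    by (intro eventually_ball_finite ballI eventually_eval_bipoly_pos) (auto simp: facet_point_def)
  then show ?thesis
  proof eventually_elim
    case (elim s)
    have "eval_bipoly (p i) (y + s *\<^sub>R normal (p i)) = s * (normal (p i) \<bullet> normal (p i))"
      using y i by (simp add: facet_point_def eval_degree_one_add deg)
    then have "eval_bipoly (p i) (y + s *\<^sub>R normal (p i)) \<ge> 0 \<longleftrightarrow> s \<ge> 0"
      using normal_nonzero[OF i] by (simp add: zero_le_mult_iff not_le flip: inner_gt_zero_iff)
    moreover have "y + s *\<^sub>R normal (p i) \<in> P
        \<longleftrightarrow> eval_bipoly (p i) (y + s *\<^sub>R normal (p i)) \<ge> 0"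
      using elim i unfolding mem_P_iff by (metis DiffI less_eq_real_def singletonD)
    ultimately show ?case by simp
  qed
qed

lemma generic_facet_point:
  assumes i: "i \<in> I" and ndvd: "\<not> p i dvd g"
  obtains z where "facet_point i z" "eval_bipoly g z \<noteq> 0"
proof -
  let ?v = "rot (normal (p i))"
  obtain y where y: "facet_point i y" using facet_point_exists i by blast
  obtain d where d: "d > 0" "\<And>t. dist t 0 < d \<Longrightarrow> facet_point i (y + t *\<^sub>R ?v)"
    using eventually_facet_point[OF y i] by (auto simp: eventually_nhds_metric)
  have "infinite ((\<lambda>t. y + t *\<^sub>R ?v) ` {0<..<d})"
    using d(1) by (intro infinite_line_image) (simp_all add: normal_nonzero i)
  moreover have "finite {x. eval_bipoly (p i) x = 0 \<and> eval_bipoly g x = 0}"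
    using degree_one_dvdI[OF deg[OF i]] ndvd by blast
  ultimately obtain t where t: "t \<in> {0<..<d}"
      "y + t *\<^sub>R ?v \<notin> {x. eval_bipoly (p i) x = 0 \<and> eval_bipoly g x = 0}"
    using finite_subset by (metis (no_types, lifting) image_subsetI)
  then have "facet_point i (y + t *\<^sub>R ?v)" by (intro d) (simp add: dist_real_def)
  with t(2) show thesis using that by (auto simp: facet_point_def)
qed

section \<open>Descriptions of the polygon by two polynomials\<close>

text \<open>
  Otherwise \<open>f\<close> and \<open>g\<close> are both positive at some point in the interior of an edge, hence around it,
  and \<open>P\<close> would extend beyond the edge.
\<close>

lemma dvd_one_of_two:
  assumes P: "P = nonneg_set {f, g}" and i: "i \<in> I"
  shows "p i dvd f \<or> p i dvd g"
proof (rule ccontr)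
  assume "\<not> (p i dvd f \<or> p i dvd g)"
  then have "\<not> p i dvd f * g"
    using prime_elem_dvd_mult_iff[OF prime_elem_degree_one[OF deg[OF i]]] by blast
  then obtain z where z: "facet_point i z" "eval_bipoly (f * g) z \<noteq> 0"
    using generic_facet_point[OF i] by blast
  then have "eval_bipoly f z > 0" "eval_bipoly g z > 0"
    using facet_point_in_P[OF z(1)] by (auto simp: P mem_nonneg_set_pair eval_bipoly_mult)
  from this[THEN eventually_eval_bipoly_pos, of "normal (p i)"]
    eventually_transversal_mem_P_iff[OF z(1) i]
  have "\<forall>\<^sub>F s in nhds (0::real). s \<ge> 0"
    by eventually_elim (auto simp: P mem_nonneg_set_pair)
  then show False by (rule eventually_nhds_0_symmetric) simp
qed

text \<open>Otherwise the whole line \<open>p i = 0\<close> is contained in \<open>P\<close>, which is bounded.\<close>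

lemma not_dvd_both:
  assumes P: "P = nonneg_set {f, g}" and i: "i \<in> I" and "p i dvd f" "p i dvd g"
  shows False
proof -
  let ?v = "rot (normal (p i))"
  obtain y where y: "eval_bipoly (p i) y = 0" using eval_degree_one_zero_exists deg i by blast
  have line: "y + t *\<^sub>R ?v \<in> P" for t
    using assms eval_bipoly_eq_0_if_dvd[of "p i" _ "y + t *\<^sub>R ?v"] y
    by (simp add: eval_degree_one_rot deg mem_nonneg_set_pair)
  obtain B where B: "\<And>x. x \<in> P \<Longrightarrow> norm x \<le> B"
    using bounded_P by (auto simp: bounded_iff)
  define t where "t = (norm y + B + 1) / norm ?v"
  have v: "norm ?v > 0" using normal_nonzero[OF i] by simp
  have "B \<ge> 0" using B[OF line[of 0]] norm_ge_zero order_trans by blast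
  then have "norm (t *\<^sub>R ?v) = norm y + B + 1" using v by (simp add: t_def)
  moreover have "norm (t *\<^sub>R ?v) \<le> norm (y + t *\<^sub>R ?v) + norm y"
    by (metis add.commute add_diff_cancel_left' norm_triangle_ineq4)
  ultimately show False using B[OF line[of t]] by simp
qed

lemma neg_on_line_outside:
  assumes P: "P = nonneg_set {f, g}" and "p i dvd f"
    and "eval_bipoly (p i) x = 0" and "x \<notin> P"
  shows "eval_bipoly g x < 0"
  using assms eval_bipoly_eq_0_if_dvd[of "p i" f x] by (auto simp: mem_nonneg_set_pair)

text \<open>
  At a common zero of \<open>p i\<close> and \<open>p j\<close> outside \<open>P\<close>, the polynomial \<open>g\<close> would vanish because of
  \<open>p j dvd g\<close>, and be negative because of \<open>p i dvd f\<close>.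
\<close>

lemma parallel_or_meet_in_P:
  assumes P: "P = nonneg_set {f, g}" and I: "i \<in> I" "j \<in> I"
    and dvd: "p i dvd f" "p j dvd g"
  shows "parallel i j \<or> meet_in_P i j"
proof (rule ccontr)
  assume *: "\<not> (parallel i j \<or> meet_in_P i j)"
  then obtain x where x: "eval_bipoly (p i) x = 0" "eval_bipoly (p j) x = 0"
    using lines_meet[OF I] by blast
  with * have "x \<notin> P" by blast
  then have "eval_bipoly g x < 0" by (rule neg_on_line_outside[OF P dvd(1) x(1)])
  with eval_bipoly_eq_0_if_dvd[OF dvd(2) x(2)] show False by simp
qed

lemma card_other_divisors_le_3:
  assumes P: "P = nonneg_set {f, g}" and i: "i \<in> I" "p i dvd f"
  shows "card {j \<in> I. p j dvd g} \<le> 3"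
proof -
  have "{j \<in> I. p j dvd g} \<subseteq> {j \<in> I - {i}. parallel i j} \<union> {j \<in> I - {i}. meet_in_P i j}"
    using parallel_or_meet_in_P[OF P i(1) _ i(2)] not_dvd_both[OF P i] by blast
  then have "card {j \<in> I. p j dvd g}
      \<le> card ({j \<in> I - {i}. parallel i j} \<union> {j \<in> I - {i}. meet_in_P i j})"
    using finite_I by (intro card_mono) auto
  also have "\<dots> \<le> card {j \<in> I - {i}. parallel i j} + card {j \<in> I - {i}. meet_in_P i j}"
    by (rule card_Un_le)
  also have "\<dots> \<le> 3"
    using card_parallel_le_1[OF i(1)] card_meeting_le_2[OF i(1)] by simp
  finally show ?thesis .
qed

text \<open>
  If both polynomials had divisors among the \<open>p i\<close>, each of them would have at most three, and there
  would be at most six edges.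
\<close>

lemma all_divide_one_of_two:
  assumes P: "P = nonneg_set {f, g}" and "card I \<ge> 7"
  shows "(\<forall>i\<in>I. p i dvd f \<and> \<not> p i dvd g) \<or> (\<forall>i\<in>I. p i dvd g \<and> \<not> p i dvd f)"
proof -
  have P': "P = nonneg_set {g, f}" by (simp add: P insert_commute)
  let ?A = "{j \<in> I. p j dvd f}" and ?B = "{j \<in> I. p j dvd g}"
  have un: "I = ?A \<union> ?B" using dvd_one_of_two[OF P] by blast
  have "?A = {} \<or> ?B = {}"
  proof (rule ccontr)
    assume "\<not> (?A = {} \<or> ?B = {})"
    then have "card ?B \<le> 3" "card ?A \<le> 3"
      using card_other_divisors_le_3[OF P] card_other_divisors_le_3[OF P'] by blast+
    moreover have "card I \<le> card ?A + card ?B"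
      using un card_Un_le[of ?A ?B] by simp
    ultimately show False using assms(2) by simp
  qed
  then show ?thesis using un by blast
qed

text \<open>If \<open>f = 0\<close>, then \<open>g\<close> alone describes \<open>P\<close> and has to vanish on every edge.\<close>

lemma nonzero_if_not_dvd:
  assumes P: "P = nonneg_set {f, g}" and i: "i \<in> I" "\<not> p i dvd g"
  shows "f \<noteq> 0"
proof
  assume "f = 0"
  then have "P = nonneg_set {g, g}"
    by (auto simp: P nonneg_set_def eval_bipoly_def)
  with dvd_one_of_two[OF _ i(1), of g g] i(2) show False by blast
qed

text \<open>
  Crossing a facet at a point where the cofactor and \<open>g\<close> do not vanish leaves \<open>P\<close> while \<open>g\<close> stays
  positive, so it is \<open>f\<close> that has to change sign.
\<close>

lemma odd_exponent:
  assumes P: "P = nonneg_set {f, g}" and i: "i \<in> I" "\<not> p i dvd g"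
    and f: "f = p i ^ k * h" "\<not> p i dvd h"
  shows "odd k"
proof
  assume k: "even k"
  let ?n = "normal (p i)"
  have "\<not> p i dvd g * h"
    using prime_elem_dvd_mult_iff[OF prime_elem_degree_one[OF deg[OF i(1)]]] i f by blast
  then obtain z where z: "facet_point i z" "eval_bipoly (g * h) z \<noteq> 0"
    using generic_facet_point[OF i(1)] by blast
  then have g: "eval_bipoly g z > 0" and h: "eval_bipoly h z \<noteq> 0"
    using facet_point_in_P[OF z(1)] by (auto simp: P mem_nonneg_set_pair eval_bipoly_mult)
  have eval_f: "eval_bipoly f (z + s *\<^sub>R ?n)
      = (s * (?n \<bullet> ?n)) ^ k * eval_bipoly h (z + s *\<^sub>R ?n)" for s
    using z(1) i
    by (simp add: f eval_bipoly_mult eval_bipoly_power eval_degree_one_add deg facet_point_def)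
  have pos: "(s * (?n \<bullet> ?n)) ^ k > 0" if "s \<noteq> 0" for s
    using k that normal_nonzero[OF i(1)] by (simp add: zero_less_power_eq)
  note ev = eventually_eval_bipoly_pos[OF g, of ?n] eventually_transversal_mem_P_iff[OF z(1) i(1)]
  consider "eval_bipoly h z > 0" | "eval_bipoly (- h) z > 0"
    using h by (fastforce simp: eval_bipoly_def)
  then show False
  proof cases
    case 1
    from ev eventually_eval_bipoly_pos[OF 1, of ?n]
    have "\<forall>\<^sub>F s in nhds (0::real). s \<noteq> 0 \<longrightarrow> s \<ge> 0"
      by eventually_elim (use pos in \<open>auto simp: P mem_nonneg_set_pair eval_f zero_le_mult_iff less_imp_le\<close>)
    then show False by (rule eventually_nhds_0_symmetric) simp
  next
    case 2
    from ev eventually_eval_bipoly_pos[OF 2, of ?n]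
    have "\<forall>\<^sub>F s in nhds (0::real). s \<noteq> 0 \<longrightarrow> s < 0"
    proof eventually_elim
      case (elim s)
      show ?case
      proof
        assume "s \<noteq> 0"
        moreover have "eval_bipoly h (z + s *\<^sub>R ?n) < 0"
          using elim(3) by (simp add: eval_bipoly_def)
        ultimately have "eval_bipoly f (z + s *\<^sub>R ?n) < 0"
          unfolding eval_f by (simp add: pos mult_pos_neg)
        then show "s < 0" using elim(2) by (auto simp: P mem_nonneg_set_pair)
      qed
    qed
    then show False by (rule eventually_nhds_0_symmetric) simp
  qed
qed

lemma extreme_point_not_between:
  assumes y: "y extreme_point_of P" and "v \<noteq> 0" and "s > 0" "t > 0"
    and inP: "y + s *\<^sub>R v \<in> P" "y - t *\<^sub>R v \<in> P"
  shows False
proof -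
  have "y \<in> open_segment (y - t *\<^sub>R v) (y + s *\<^sub>R v)"
    unfolding in_segment
  proof (intro conjI exI[of _ "t / (s + t)"])
    have "(s + t) *\<^sub>R v \<noteq> 0" using assms by simp
    then show "y - t *\<^sub>R v \<noteq> y + s *\<^sub>R v" by (auto simp: algebra_simps)
    have "(1 - t / (s + t)) *\<^sub>R (y - t *\<^sub>R v) + (t / (s + t)) *\<^sub>R (y + s *\<^sub>R v)
        = y + ((t / (s + t)) * s - (1 - t / (s + t)) * t) *\<^sub>R v"
      by (simp add: algebra_simps)
    also have "(t / (s + t)) * s - (1 - t / (s + t)) * t = 0"
      using assms by (simp add: field_simps)
    finally show "y = (1 - t / (s + t)) *\<^sub>R (y - t *\<^sub>R v) + (t / (s + t)) *\<^sub>R (y + s *\<^sub>R v)"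
      by simp
  qed (use assms in auto)
  with y inP show False by (auto simp: extreme_point_of_def)
qed

text \<open>Where all \<open>p i\<close> are positive, \<open>P\<close> contains a segment around the point.\<close>

lemma extreme_point_on_line:
  assumes y: "y extreme_point_of P"
  obtains i where "i \<in> I" "eval_bipoly (p i) y = 0"
proof (rule ccontr)
  assume "\<not> thesis"
  then have "\<forall>i\<in>I. eval_bipoly (p i) y > 0"
    using y that mem_P_iff by (force simp: extreme_point_of_def)
  then have "\<forall>\<^sub>F s in nhds 0. \<forall>i\<in>I. eval_bipoly (p i) (y + s *\<^sub>R axis 1 1) > 0"
    using finite_I by (intro eventually_ball_finite ballI eventually_eval_bipoly_pos) auto
  then have "\<forall>\<^sub>F s in nhds 0. y + s *\<^sub>R axis 1 1 \<in> P"
    by eventually_elim (auto simp: mem_P_iff intro: less_imp_le)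
  then obtain s where "s > 0" "y + s *\<^sub>R axis 1 1 \<in> P" "y + (- s) *\<^sub>R axis 1 1 \<in> P"
    by (rule eventually_nhds_0_symmetric)
  then show False
    using extreme_point_not_between[OF y, of "axis 1 1" s s] by (simp add: axis_eq_0_iff)
qed

text \<open>
  From an extreme point \<open>y\<close> on the line \<open>p i = 0\<close>, one of the two rays of this line leaves \<open>P\<close> at
  once. Since \<open>p i dvd f\<close>, the polynomial \<open>g\<close> is negative on this ray, so that it is at most \<open>0\<close> at
  \<open>y\<close>; it is nonnegative there because \<open>y\<close> belongs to \<open>P\<close>.
\<close>

lemma zero_at_extreme_point:
  assumes P: "P = nonneg_set {f, g}" and dvd: "\<forall>i\<in>I. p i dvd f"
    and y: "y extreme_point_of P"
  shows "eval_bipoly g y = 0"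
proof -
  obtain i where i: "i \<in> I" "eval_bipoly (p i) y = 0" using extreme_point_on_line[OF y] .
  let ?v = "rot (normal (p i))"
  have ray: "eval_bipoly g y = 0" if w: "w = ?v \<or> w = - ?v" and out: "\<forall>s>0. y + s *\<^sub>R w \<notin> P" for w
  proof (rule ccontr)
    assume "eval_bipoly g y \<noteq> 0"
    moreover have "y \<in> P" using y by (simp add: extreme_point_of_def)
    ultimately have "eval_bipoly g y > 0" by (simp add: P mem_nonneg_set_pair)
    then have "\<forall>\<^sub>F s in nhds 0. eval_bipoly g (y + s *\<^sub>R w) > 0"
      by (rule eventually_eval_bipoly_pos)
    then obtain s where s: "s > 0" "eval_bipoly g (y + s *\<^sub>R w) > 0"
      by (rule eventually_nhds_0_symmetric)
    have "eval_bipoly (p i) (y + s *\<^sub>R w) = 0"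
      using w i by (auto simp: eval_degree_one_add deg)
    then have "eval_bipoly g (y + s *\<^sub>R w) < 0"
      using neg_on_line_outside[OF P] dvd i(1) out s(1) by blast
    with s(2) show False by simp
  qed
  show ?thesis
  proof (cases "\<exists>s>0. y + s *\<^sub>R ?v \<in> P")
    case True
    then have "\<forall>t>0. y + t *\<^sub>R (- ?v) \<notin> P"
      using extreme_point_not_between[OF y, of ?v] normal_nonzero[OF i(1)] by auto
    then show ?thesis using ray by blast
  next
    case False
    then show ?thesis using ray by blast
  qed
qed

lemma not_dvd_other:
  assumes "i \<in> I" "j \<in> I" "i \<noteq> j"
  shows "\<not> p i dvd p j"
proof
  assume dvd: "p i dvd p j"
  obtain y where "facet_point i y" using facet_point_exists assms by blast
  then show False
    using eval_bipoly_eq_0_if_dvd[OF dvd, of y] assms by (force simp: facet_point_def)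
qed

end

section \<open>The edges of a polygon given by as many inequalities as it has edges\<close>

lemma face_of_zero_set:
  assumes deg: "total_degree l = 1" and S: "convex S" "\<And>x. x \<in> S \<Longrightarrow> eval_bipoly l x \<ge> 0"
  shows "(S \<inter> {x. eval_bipoly l x = 0}) face_of S"
proof -
  define c where "c = eval_bipoly l 0"
  have ev: "eval_bipoly l x = c + normal l \<bullet> x" for x
    using eval_degree_one_add[OF deg, of 0 x] by (simp add: c_def)
  have "{x. eval_bipoly l x = 0} = {x. normal l \<bullet> x = - c}"
    by (auto simp: ev)
  moreover have "normal l \<bullet> x \<ge> - c" if "x \<in> S" for x
    using S(2)[OF that] by (simp add: ev)
  ultimately show ?thesis
    using face_of_Int_supporting_hyperplane_ge[OF S(1)] by simp
qed

text \<open>The zero set is a face, and a face that contains a relative interior point is everything.\<close>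

lemma zero_on_if_zero_in_rel_interior:
  assumes "total_degree l = 1" and "convex S" "\<And>x. x \<in> S \<Longrightarrow> eval_bipoly l x \<ge> 0"
    and y: "y \<in> rel_interior S" "eval_bipoly l y = 0"
  shows "S \<subseteq> {x. eval_bipoly l x = 0}"
  using face_of_disjoint_rel_interior[OF face_of_zero_set[OF assms(1-3)]] y
    rel_interior_subset[of S] by blast

lemma aff_dim_zero_set_face:
  assumes F: "(S \<inter> {x. eval_bipoly l x = 0}) face_of S"
    and deg: "total_degree l = 1" and S: "convex S" "interior S \<noteq> {}"
  shows "aff_dim (S \<inter> {x. eval_bipoly l x = 0}) \<le> 1"
proof -
  have "S \<inter> {x. eval_bipoly l x = 0} \<noteq> S"
  proof
    assume eq: "S \<inter> {x. eval_bipoly l x = 0} = S"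
    obtain z where z: "z \<in> interior S" using S by blast
    then obtain e where e: "e > 0" "ball z e \<subseteq> S" using mem_interior by blast
    \<comment> \<open>A nonconstant affine function changes along its gradient inside a small ball.\<close>
    define s where "s = e / (2 * norm (normal l))"
    have n: "norm (normal l) > 0" using degree_one_form(2)[OF deg] by simp
    have zero: "eval_bipoly l x = 0" if "x \<in> ball z e" for x
      using subsetD[OF e(2) that] subsetD[OF equalityD2[OF eq]] by blast
    have "norm (s *\<^sub>R normal l) = e / 2" using n e(1) by (simp add: s_def)
    then have "eval_bipoly l (z + s *\<^sub>R normal l) = 0" "eval_bipoly l z = 0"
      using e(1) by (simp_all add: zero dist_norm)
    then have "s * (normal l \<bullet> normal l) = 0" by (simp add: eval_degree_one_add[OF deg])
    then show False using n e(1) by (simp add: s_def)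
  qed
  then have "aff_dim (S \<inter> {x. eval_bipoly l x = 0}) < aff_dim S"
    by (rule face_of_aff_dim_lt[OF S(1) F])
  also have "aff_dim S \<le> 2" using aff_dim_le_DIM[of S] by simp
  finally show ?thesis by simp
qed

lemma interior_if_all_pos:
  assumes "finite G" and "P = nonneg_set G" and "\<And>g. g \<in> G \<Longrightarrow> eval_bipoly g x > 0"
  shows "x \<in> interior P"
proof (rule interiorI)
  have "open {y. eval_bipoly g y > 0}" for g
    using continuous_on_eval_bipoly[of UNIV g] by (intro open_Collect_less) auto
  then show "open (\<Inter>g\<in>G. {y. eval_bipoly g y > 0})" using assms(1) by blast
qed (use assms in \<open>auto simp: nonneg_set_def intro: less_imp_le\<close>)

text \<open>
  Every edge of \<open>P\<close> is the zero set in \<open>P\<close> of some \<open>p i\<close>: a relative interior point of the edge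
  lies on the boundary of \<open>P\<close>, hence some \<open>p i\<close> vanishes there, and then on the whole edge. As there
  are as many edges as indices, each \<open>p i\<close> cuts out an edge of its own.
\<close>

lemma zero_sets_are_distinct_edges:
  assumes I: "finite I" "card {e. e edge_of P} = card I"
    and deg: "\<And>i. i \<in> I \<Longrightarrow> total_degree (p i) = 1"
    and P: "P = nonneg_set (p ` I)" "convex P" "interior P \<noteq> {}"
  defines "edge \<equiv> \<lambda>i. P \<inter> {x. eval_bipoly (p i) x = 0}"
  shows "inj_on edge I" and "\<And>i. i \<in> I \<Longrightarrow> edge i edge_of P"
proof -
  have nonneg: "eval_bipoly (p i) x \<ge> 0" if "i \<in> I" "x \<in> P" for i x
    using that by (simp add: P(1) nonneg_set_def)
  have face: "edge i face_of P" if "i \<in> I" for i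
    unfolding edge_def by (rule face_of_zero_set) (use that deg P nonneg in auto)
  have dim: "aff_dim (edge i) \<le> 1" if "i \<in> I" for i
    using aff_dim_zero_set_face[OF face[OF that, unfolded edge_def] deg[OF that] P(2,3)]
    by (simp add: edge_def)
  have sub: "{e. e edge_of P} \<subseteq> edge ` I"
  proof
    fix e assume "e \<in> {e. e edge_of P}"
    then have e: "e face_of P" "aff_dim e = 1" by (auto simp: edge_of_def)
    have "convex e" using e(1) by (rule face_of_imp_convex)
    moreover have "e \<noteq> {}" using e(2) by auto
    ultimately obtain y where y: "y \<in> rel_interior e"
      using rel_interior_eq_empty by blast
    have eP: "e \<subseteq> P" using e(1) by (rule face_of_imp_subset)
    have "aff_dim P = 2"
      using aff_dim_nonempty_interior[OF P(3)] by simp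
    then have "e \<noteq> P" using e(2) by auto
    then have "y \<notin> interior P"
      using face_of_disjoint_interior[OF e(1)] y rel_interior_subset[of e] by blast
    then obtain i where i: "i \<in> I" "\<not> eval_bipoly (p i) y > 0"
      using interior_if_all_pos[of "p ` I" P y] I(1) P(1) by auto
    have "eval_bipoly (p i) y = 0"
      using i nonneg[of i y] y eP rel_interior_subset[of e] by force
    then have "e \<subseteq> {x. eval_bipoly (p i) x = 0}"
      using zero_on_if_zero_in_rel_interior[OF deg[OF i(1)] \<open>convex e\<close> _ y] nonneg[OF i(1)] eP
      by blast
    then have "e \<subseteq> edge i" using eP by (auto simp: edge_def)
    then have F: "e face_of edge i"
      using face_of_subset[OF e(1)] by (simp add: edge_def)
    have "convex (edge i)" using face[OF i(1)] by (rule face_of_imp_convex)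
    then have "e = edge i" using face_of_aff_dim_lt[OF _ F] e(2) dim[OF i(1)] by fastforce
    then show "e \<in> edge ` I" using i(1) by blast
  qed
  have "card (edge ` I) \<le> card {e. e edge_of P}" using card_image_le I by metis
  then have eq: "{e. e edge_of P} = edge ` I"
    using sub I(1) by (intro card_seteq) auto
  then show "inj_on edge I" using I by (intro eq_card_imp_inj_on) simp_all
  show "edge i edge_of P" if "i \<in> I" for i using eq that by blast
qed

text \<open>
  A relative interior point of the edge of \<open>p i\<close> serves as the boundary point of its own: if another
  \<open>p j\<close> vanished there, it would vanish on the whole edge, and the two edges would coincide.
\<close>

lemma irredundant_polygonI:
  assumes I: "finite I" "card {e. e edge_of P} = card I"
    and deg: "\<And>i. i \<in> I \<Longrightarrow> total_degree (p i) = 1"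
    and P: "P = nonneg_set (p ` I)" "convex_polygon P"
  shows "irredundant_polygon P I p"
proof
  have conv: "convex P" "interior P \<noteq> {}" "bounded P"
    using P(2) by (simp_all add: convex_polygon_def polytope_imp_convex polytope_imp_bounded)
  define edge where "edge = (\<lambda>i. P \<inter> {x. eval_bipoly (p i) x = 0})"
  have inj: "inj_on edge I" and edge: "\<And>i. i \<in> I \<Longrightarrow> edge i edge_of P"
    unfolding edge_def using zero_sets_are_distinct_edges[OF I deg P(1) conv(1,2)] by blast+
  show "bounded P" by (rule conv)
  have nonneg: "eval_bipoly (p i) x \<ge> 0" if "i \<in> I" "x \<in> P" for i x
    using that by (simp add: P(1) nonneg_set_def)
  fix i assume i: "i \<in> I"
  have cvx: "convex (edge i)" and ne: "edge i \<noteq> {}"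
    using edge[OF i] face_of_imp_convex by (auto simp: edge_of_def)
  then obtain y where y: "y \<in> rel_interior (edge i)" using rel_interior_eq_empty by blast
  then have yi: "y \<in> edge i" using rel_interior_subset by blast
  have "eval_bipoly (p j) y > 0" if j: "j \<in> I" "j \<noteq> i" for j
  proof (rule ccontr)
    assume "\<not> eval_bipoly (p j) y > 0"
    then have "eval_bipoly (p j) y = 0" using nonneg[OF j(1), of y] yi by (simp add: edge_def)
    then have "edge i \<subseteq> {x. eval_bipoly (p j) x = 0}"
      using zero_on_if_zero_in_rel_interior[OF deg[OF j(1)] cvx _ y] nonneg[OF j(1)]
      by (simp add: edge_def)
    then have "edge i \<subseteq> edge j" by (auto simp: edge_def)
    then have F: "edge i face_of edge j"
      using edge[OF i] edge[OF j(1)] face_of_subset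
      by (meson edge_of_def edge_of_imp_subset)
    have "convex (edge j)" using edge[OF j(1)] by (auto simp: edge_of_def face_of_imp_convex)
    then have "edge i = edge j"
      using face_of_aff_dim_lt[OF _ F] edge[OF i] edge[OF j(1)] by (auto simp: edge_of_def)
    then show False using inj i j by (auto dest: inj_onD)
  qed
  then show "\<exists>y. eval_bipoly (p i) y = 0 \<and> (\<forall>j\<in>I - {i}. eval_bipoly (p j) y > 0)"
    using yi by (auto simp: edge_def)
qed (use assms in auto)

section \<open>The factorisation\<close>

lemma (in irredundant_polygon) factorisation:
  assumes P: "P = nonneg_set {f, g}" and "I \<noteq> {}"
    and dvd: "\<forall>i\<in>I. p i dvd f \<and> \<not> p i dvd g"
  shows "\<exists>k h. f = (\<Prod>i\<in>I. p i ^ k i) * h \<and> (\<forall>i\<in>I. odd (k i))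
    \<and> (\<forall>i\<in>I. \<not> p i dvd h \<and> \<not> p i dvd g)
    \<and> (\<forall>y. y extreme_point_of P \<longrightarrow> eval_bipoly g y = 0)"
proof -
  let ?k = "\<lambda>i. multiplicity (p i) f"
  have f: "f \<noteq> 0" using nonzero_if_not_dvd[OF P] dvd assms(2) by blast
  have prime: "prime_elem (p i)" if "i \<in> I" for i using that by (rule prime_elem_degree_one[OF deg])
  obtain h where h: "f = (\<Prod>i\<in>I. p i ^ ?k i) * h" "\<forall>i\<in>I. \<not> p i dvd h"
    by (rule prod_multiplicity_decompose[OF finite_I f, of p]) (use prime not_dvd_other in auto)
  have "odd (?k i)" if i: "i \<in> I" for i
  proof -
    have "\<not> is_unit (p i)" using prime[OF i] by (simp add: prime_elem_def)
    then obtain h' where "f = p i ^ ?k i * h'" "\<not> p i dvd h'"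
      using multiplicity_decompose'[OF f] by blast
    then show ?thesis using odd_exponent[OF P i] dvd i by blast
  qed
  moreover have "\<forall>y. y extreme_point_of P \<longrightarrow> eval_bipoly g y = 0"
    using zero_at_extreme_point[OF P] dvd by blast
  ultimately have "f = (\<Prod>i\<in>I. p i ^ ?k i) * h \<and> (\<forall>i\<in>I. odd (?k i))
    \<and> (\<forall>i\<in>I. \<not> p i dvd h \<and> \<not> p i dvd g)
    \<and> (\<forall>y. y extreme_point_of P \<longrightarrow> eval_bipoly g y = 0)"
    using h dvd by (intro conjI ballI) simp_all
  then show ?thesis by (intro exI)
qed

theorem corollary1p6:
  fixes P :: "(real ^ 2) set"
    and m :: nat
    and p :: "nat \<Rightarrow> bipoly"
    and q1 q2 :: bipoly
  assumes "convex_polygon P"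
    and "card {e. e edge_of P} = m"
    and "m \<ge> 7"
    and "P = nonneg_set (p ` {1..m})"
    and "P = nonneg_set {q1, q2}"
    and "\<forall>i\<in>{1..m}. total_degree (p i) = 1"
  shows "\<exists>(k :: nat \<Rightarrow> nat) (g1 :: bipoly) (g2 :: bipoly).
           {q1, q2} = {(\<Prod>i\<in>{1..m}. p i ^ k i) * g1, g2}
         \<and> (\<forall>i\<in>{1..m}. odd (k i))
         \<and> (\<forall>i\<in>{1..m}. \<not> p i dvd g1 \<and> \<not> p i dvd g2)
         \<and> (\<forall>y. y extreme_point_of P \<longrightarrow> eval_bipoly g2 y = 0)"
proof -
  interpret irredundant_polygon P "{1..m}" p
    using assms by (intro irredundant_polygonI) auto
  have ne: "{1..m} \<noteq> {}" and P': "P = nonneg_set {q2, q1}"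
    using assms(3,5) by (auto simp: insert_commute)
  have "(\<forall>i\<in>{1..m}. p i dvd q1 \<and> \<not> p i dvd q2) \<or> (\<forall>i\<in>{1..m}. p i dvd q2 \<and> \<not> p i dvd q1)"
    using all_divide_one_of_two[OF assms(5)] assms(3) by simp
  then show ?thesis
  proof
    assume "\<forall>i\<in>{1..m}. p i dvd q1 \<and> \<not> p i dvd q2"
    then obtain k h where kh: "q1 = (\<Prod>i\<in>{1..m}. p i ^ k i) * h"
      and *: "\<forall>i\<in>{1..m}. odd (k i)" "\<forall>i\<in>{1..m}. \<not> p i dvd h \<and> \<not> p i dvd q2"
        "\<forall>y. y extreme_point_of P \<longrightarrow> eval_bipoly q2 y = 0"
      using factorisation[OF assms(5) ne] by blast
    show ?thesis
      by (rule exI[of _ k], rule exI[of _ h], rule exI[of _ q2]) (intro conjI *, simp only: kh)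
  next
    assume "\<forall>i\<in>{1..m}. p i dvd q2 \<and> \<not> p i dvd q1"
    then obtain k h where kh: "q2 = (\<Prod>i\<in>{1..m}. p i ^ k i) * h"
      and *: "\<forall>i\<in>{1..m}. odd (k i)" "\<forall>i\<in>{1..m}. \<not> p i dvd h \<and> \<not> p i dvd q1"
        "\<forall>y. y extreme_point_of P \<longrightarrow> eval_bipoly q1 y = 0"
      using factorisation[OF P' ne] by blast
    show ?thesis
      by (rule exI[of _ k], rule exI[of _ h], rule exI[of _ q1])
        (intro conjI *, simp only: kh insert_commute)
  qed
qed

end
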